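(* Let $m\ge 1$ be an odd integer and let $X\in\mathcal{G}_{4m^{2}}(2m^{2}+m)$. If $X_C$ is a circulant Hadamard matrix of order $4m^2$, then $X\in\mathcal{G}_{2m^{2}}(2m^{2}-a)\times\mathcal{G}_{2m^{2}}(b)$ for some integers $a,b$ with $$\frac{m^{2}+m}{2}\leq 2m^{2}-a\leq\frac{3m^{2}+m}{2}\qquad\text{and}\qquad b=m+a.$$
   Context: $\mathbb{Z}_2=\{+1,-1\}$ is the multiplicative group of order 2, and $\mathbb{Z}_2^n$ is the set of sequences of length $n$ with entries $\pm1$. The Hamming weight $\omega(X)$ of $X\in\mathbb{Z}_2^n$ is the number of entries of $X$ equal to $+1$. For $0\le k\le n$, $\mathcal{G}_n(k)=\{X\in\mathbb{Z}_2^n:\omega(X)=k\}$. The product $\mathcal{G}_{2m^2}(c)\times\mathcal{G}_{2m^2}(d)$ is viewed inside $\mathbb{Z}_2^{4m^2}$ by concatenation: it is the set of sequences $(B,D)$ with $B\in\mathcal{G}_{2m^2}(c)$ (first $2m^2$ entries) and $D\in\mathcal{G}_{2m^2}(d)$ (last $2m^2$ entries). $C$ is the cyclic shift $C(x_0,x_1,\dots,x_{n-1})=(x_1,\dots,x_{n-1},x_0)$, and $X_C=\{C^i(X): 0\le i\le n-1\}$ is the orbit of $X$, identified with the circulant matrix having first row $X$ and whose rows are the cyclic shifts of $X$. A Hadamard matrix of order $n$ is an $n\times n$ matrix $H$ with entries $\pm1$ and $HH^{t}=nI_n$; "$X_C$ is a circulant Hadamard matrix" means that the circulant matrix with first row $X$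 is Hadamard. *)

theory Defs
  imports Complex_Main "Jordan_Normal_Form.Matrix"
begin

definition Z2_seqs :: "nat \<Rightarrow> int list set" where
  "Z2_seqs n = {X. length X = n \<and> set X \<subseteq> {1, -1}}"

definition hamming_weight :: "int list \<Rightarrow> nat" where
  "hamming_weight X = count_list X 1"

(* The weight k is an integer so that expressions such as 2 * m^2 - a involve no truncated
   subtraction; the class is empty unless 0 <= k <= n. *)
definition weight_class :: "nat \<Rightarrow> int \<Rightarrow> int list set" where
  "weight_class n k = {X \<in> Z2_seqs n. int (hamming_weight X) = k}"

definition concat_product :: "int list set \<Rightarrow> int list set \<Rightarrow> int list set" where
  "concat_product S T = {B @ D | B D. B \<in> S \<and> D \<in> T}"

(* rotate i is the i-th iterate of rotate1, which sends [x_0, ..., x_(n-1)] to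
   [x_1, ..., x_(n-1), x_0]. *)
definition circulant_mat :: "int list \<Rightarrow> int mat" where
  "circulant_mat X = mat_of_rows_list (length X) (map (\<lambda>i. rotate i X) [0..<length X])"

definition hadamard_mat :: "nat \<Rightarrow> int mat \<Rightarrow> bool" where
  "hadamard_mat n H \<longleftrightarrow>
     H \<in> carrier_mat n n \<and> elements_mat H \<subseteq> {1, -1} \<and>
     H * transpose_mat H = int n \<cdot>\<^sub>m 1\<^sub>m n"

end

theory Submission
  imports Defs
begin

text \<open>
  Write \<open>n = 4 m\<^sup>2 = 2 h\<close>, extend the sequence \<open>X\<close> periodically to \<open>x\<close>, and let \<open>f i\<close> be the
  sum of the \<open>h\<close> entries of \<open>x\<close> starting at \<open>i\<close> minus the sum of the \<open>h\<close> entries after those.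
  If the halves of \<open>X\<close> have weights \<open>p\<close> and \<open>q\<close>, then \<open>f 0 = 2 (p - q)\<close> while \<open>p + q = h + m\<close>, so
  the bounds on \<open>p = 2 m\<^sup>2 - a\<close> say exactly that \<open>\<bar>f 0\<bar> \<le> h\<close>.

  The vector of all \<open>f i\<close> is the image under the circulant matrix \<open>H\<close> of the vector consisting of
  \<open>h\<close> entries \<open>1\<close> followed by \<open>h\<close> entries \<open>-1\<close>. As \<open>H / sqrt n\<close> is orthogonal,
  the squares of the \<open>f i\<close> over a period add up to \<open>n\<^sup>2 = 4 h\<^sup>2\<close> (\<open>orthogonal_shifts_energy\<close>).
  On the other hand, \<open>f\<close> varies slowly: moving the window by one step changes \<open>f\<close> by at most \<open>4\<close>.
  So a large value \<open>f 0\<close> forces its neighbours to be large, and since \<open>f (i + h) = - f i\<close> the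
  same happens half a period later. Already eight terms violate the identity
  when \<open>\<bar>f 0\<bar> \<ge> h \<ge> 18\<close> (\<open>halves_diff_bound\<close>). This settles \<open>m \<ge> 3\<close>; for \<open>m = 1\<close>
  the trivial bounds \<open>p, q \<le> 2\<close> suffice.
\<close>

section \<open>Differences of adjacent window sums\<close>

definition halves_diff :: "nat \<Rightarrow> (nat \<Rightarrow> int) \<Rightarrow> nat \<Rightarrow> int" where
  "halves_diff h x i = (\<Sum>j<h. x (i + j)) - (\<Sum>j<h. x (i + h + j))"

lemma window_sum_Suc:
  fixes x :: "nat \<Rightarrow> int"
  shows "(\<Sum>j<h. x (Suc i + j)) = (\<Sum>j<h. x (i + j)) - x i + x (i + h)"
  by (induction h) simp_all

lemma halves_diff_Suc:
  assumes "\<And>i. x (i + 2 * h) = x i"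
  shows "halves_diff h x (Suc i) = halves_diff h x i + 2 * (x (i + h) - x i)"
proof -
  have "i + h + h = i + 2 * h" by simp
  then have "(\<Sum>j<h. x (Suc i + h + j)) = (\<Sum>j<h. x (i + h + j)) - x (i + h) + x i"
    using window_sum_Suc[of x "i + h" h] by (simp only: assms add_Suc)
  then show ?thesis
    unfolding halves_diff_def window_sum_Suc[of x i h] by (simp only: algebra_simps)
qed

lemma halves_diff_antiperiodic:
  assumes "\<And>i. x (i + 2 * h) = x i"
  shows "halves_diff h x (i + h) = - halves_diff h x i"
proof -
  have "x (i + h + h + j) = x (i + j)" for j
    using assms[of "i + j"] by (simp only: mult_2 add.assoc add.commute add.left_commute)
  then show ?thesis by (simp add: halves_diff_def)
qed

lemma abs_halves_diff_lower:
  assumes period: "\<And>i. x (i + 2 * h) = x i" and sign: "\<And>i. \<bar>x i\<bar> = 1"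
  shows "\<bar>halves_diff h x 0\<bar> - 4 * int i \<le> \<bar>halves_diff h x i\<bar>"
proof (induction i)
  case 0
  show ?case by simp
next
  case (Suc i)
  have "\<bar>x (i + h) - x i\<bar> \<le> 2"
    using sign[of i] sign[of "i + h"] by linarith
  moreover have "halves_diff h x (Suc i) = halves_diff h x i + 2 * (x (i + h) - x i)"
    using period by (rule halves_diff_Suc)
  ultimately show ?case using Suc by simp
qed

section \<open>Orthogonal cyclic shifts\<close>

text \<open>
  This is \<open>\<parallel>H v\<parallel>\<^sup>2 = n \<parallel>v\<parallel>\<^sup>2\<close> for the matrix \<open>H\<close> with entries \<open>x (i + j)\<close>. In general one would
  have to pass from \<open>H H\<^sup>t = n I\<close> to \<open>H\<^sup>t H = n I\<close>; here \<open>H\<close> is symmetric, so orthogonality of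
  the rows can be used directly after interchanging the sums.
\<close>
lemma orthogonal_shifts_energy:
  fixes x v :: "nat \<Rightarrow> int"
  assumes "\<And>j k. j < n \<Longrightarrow> k < n \<Longrightarrow> (\<Sum>i<n. x (j + i) * x (k + i)) = (if j = k then int n else 0)"
  shows "(\<Sum>i<n. (\<Sum>j<n. v j * x (i + j))\<^sup>2) = int n * (\<Sum>j<n. (v j)\<^sup>2)"
proof -
  have "(\<Sum>i<n. (\<Sum>j<n. v j * x (i + j))\<^sup>2)
      = (\<Sum>i<n. \<Sum>j<n. \<Sum>k<n. v j * v k * (x (j + i) * x (k + i)))"
    by (simp add: power2_eq_square sum_product ac_simps)
  also have "\<dots> = (\<Sum>j<n. \<Sum>i<n. \<Sum>k<n. v j * v k * (x (j + i) * x (k + i)))"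
    by (rule sum.swap)
  also have "\<dots> = (\<Sum>j<n. \<Sum>k<n. \<Sum>i<n. v j * v k * (x (j + i) * x (k + i)))"
    by (intro sum.cong refl sum.swap)
  also have "\<dots> = (\<Sum>j<n. \<Sum>k<n. v j * v k * (if j = k then int n else 0))"
    using assms by (simp flip: sum_distrib_left)
  also have "\<dots> = (\<Sum>j<n. int n * (v j)\<^sup>2)"
    by (intro sum.cong refl) (simp add: power2_eq_square if_distrib ac_simps cong: if_cong)
  finally show ?thesis by (simp add: sum_distrib_left)
qed

lemma sum_lessThan_double:
  fixes g :: "nat \<Rightarrow> int"
  shows "(\<Sum>j<2 * h. g j) = (\<Sum>j<h. g j) + (\<Sum>j<h. g (h + j))"
  using sum.nat_group[of g h 2] by (simp add: numeral_2_eq_2 add.commute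
    sum.atLeastLessThan_shift_0[of g h "h+h"] lessThan_atLeast0)

lemma halves_diff_energy:
  fixes x :: "nat \<Rightarrow> int"
  assumes "\<And>j k. j < 2 * h \<Longrightarrow> k < 2 * h \<Longrightarrow>
    (\<Sum>i<2 * h. x (j + i) * x (k + i)) = (if j = k then int (2 * h) else 0)"
  shows "(\<Sum>i<2 * h. (halves_diff h x i)\<^sup>2) = (2 * int h)\<^sup>2"
proof -
  define v :: "nat \<Rightarrow> int" where "v j = (if j < h then 1 else - 1)" for j
  have "(\<Sum>j<2 * h. v j * x (i + j)) = halves_diff h x i" for i
    by (simp add: sum_lessThan_double halves_diff_def v_def sum_negf add.assoc)
  moreover have "(\<Sum>j<2 * h. (v j)\<^sup>2) = 2 * int h"
    by (simp add: sum_lessThan_double v_def)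
  ultimately show ?thesis
    using orthogonal_shifts_energy[of "2 * h" x v] assms by (simp add: power2_eq_square)
qed

text \<open>
  If \<open>\<bar>f 0\<bar> \<ge> h\<close> for \<open>f = halves_diff h x\<close>, then \<open>f i\<close> has absolute value at least \<open>h - 4 i\<close> for
  \<open>i < 4\<close>, and these four squares occur twice in the sum of squares \<open>4 h\<^sup>2\<close>. The resulting
  inequality fails as soon as \<open>h\<^sup>2 - 24 h + 112 > 0\<close>, which holds from \<open>h = 18\<close> onwards.
\<close>
lemma halves_diff_bound:
  fixes x :: "nat \<Rightarrow> int"
  assumes period: "\<And>i. x (i + 2 * h) = x i" and sign: "\<And>i. \<bar>x i\<bar> = 1"
    and orth: "\<And>j k. j < 2 * h \<Longrightarrow> k < 2 * h \<Longrightarrow>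
      (\<Sum>i<2 * h. x (j + i) * x (k + i)) = (if j = k then int (2 * h) else 0)"
    and "18 \<le> h"
  shows "\<bar>halves_diff h x 0\<bar> < int h"
proof (rule ccontr)
  assume large: "\<not> \<bar>halves_diff h x 0\<bar> < int h"
  have sq: "(int h - 4 * int i)\<^sup>2 \<le> (halves_diff h x i)\<^sup>2" if "i < 4" for i
  proof -
    have "int h - 4 * int i \<le> \<bar>halves_diff h x i\<bar>"
      using abs_halves_diff_lower[of x h i, OF period sign] large by linarith
    moreover have "0 \<le> int h - 4 * int i" using that \<open>18 \<le> h\<close> by linarith
    ultimately show ?thesis by (metis power2_abs power_mono)
  qed
  have "2 * (\<Sum>i<4. (int h - 4 * int i)\<^sup>2) \<le> 2 * (\<Sum>i<4. (halves_diff h x i)\<^sup>2)"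
    using sq by (intro mult_left_mono sum_mono) auto
  also have "\<dots> \<le> 2 * (\<Sum>i<h. (halves_diff h x i)\<^sup>2)"
    using \<open>18 \<le> h\<close> by (simp add: sum_mono2)
  also have "\<dots> = (\<Sum>i<2 * h. (halves_diff h x i)\<^sup>2)"
    using halves_diff_antiperiodic[of x h, OF period]
    by (simp add: sum_lessThan_double add.commute)
  also have "\<dots> = (2 * int h)\<^sup>2"
    by (rule halves_diff_energy) (rule orth)
  finally have "int h * int h - 24 * int h + 112 \<le> 0"
    by (simp add: eval_nat_numeral power2_eq_square algebra_simps)
  moreover have "0 \<le> (int h - 18) * (int h - 6)"
    using \<open>18 \<le> h\<close> by (intro mult_nonneg_nonneg) linarith+
  ultimately show False by (simp add: algebra_simps)
qed

section \<open>Sign sequences and circulant matrices\<close>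

lemma sum_list_eq_count_one:
  fixes L :: "int list"
  assumes "set L \<subseteq> {1, -1}"
  shows "sum_list L = 2 * int (count_list L 1) - int (length L)"
  using assms by (induction L) auto

lemma circulant_hadamard_orthogonal:
  assumes H: "hadamard_mat n (circulant_mat X)" and len: "length X = n" and "j < n" "k < n"
  shows "(\<Sum>i<n. X ! ((j + i) mod n) * X ! ((k + i) mod n)) = (if j = k then int n else 0)"
proof -
  let ?C = "circulant_mat X"
  have C: "?C \<in> carrier_mat n n"
    and prod: "?C * transpose_mat ?C = int n \<cdot>\<^sub>m 1\<^sub>m n"
    using H by (auto simp: hadamard_mat_def)
  have entry: "?C $$ (r, i) = X ! ((r + i) mod n)" if "r < n" "i < n" for r i
    using that len by (simp add: circulant_mat_def mat_of_rows_list_def nth_rotate)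
  have "(?C * transpose_mat ?C) $$ (j, k) = (\<Sum>i<n. ?C $$ (j, i) * ?C $$ (k, i))"
    using C \<open>j < n\<close> \<open>k < n\<close> by (auto simp: scalar_prod_def lessThan_atLeast0)
  also have "\<dots> = (\<Sum>i<n. X ! ((j + i) mod n) * X ! ((k + i) mod n))"
    using \<open>j < n\<close> \<open>k < n\<close> by (simp add: entry)
  finally show ?thesis using \<open>j < n\<close> \<open>k < n\<close> by (auto simp: prod)
qed

text \<open>
  The sum of a sign sequence is twice its weight minus its length. As both halves have length \<open>h\<close>,
  \<open>halves_diff h x 0\<close> is twice the difference of their weights.
\<close>
lemma circulant_hadamard_half_weights:
  assumes H: "hadamard_mat (2 * h) (circulant_mat X)" and X: "X \<in> Z2_seqs (2 * h)" and "18 \<le> h"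
  shows "2 * \<bar>int (hamming_weight (take h X)) - int (hamming_weight (drop h X))\<bar> < int h"
proof -
  define x where "x i = X ! (i mod (2 * h))" for i
  have len: "length X = 2 * h" and signs: "set X \<subseteq> {1, -1}"
    using X by (auto simp: Z2_seqs_def)
  have "\<bar>x i\<bar> = 1" for i
  proof -
    have "x i \<in> set X" using len \<open>18 \<le> h\<close> by (simp add: x_def)
    then show ?thesis using signs by auto
  qed
  then have bound: "\<bar>halves_diff h x 0\<bar> < int h"
    using circulant_hadamard_orthogonal[OF H len] \<open>18 \<le> h\<close>
    by (intro halves_diff_bound) (auto simp: x_def)
  have "(\<Sum>j<h. x j) = sum_list (take h X)"
    using len by (auto simp: sum_list_sum_nth x_def lessThan_atLeast0 intro!: sum.cong)
  moreover have "(\<Sum>j<h. x (h + j)) = sum_list (drop h X)"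
    using len by (auto simp: sum_list_sum_nth x_def lessThan_atLeast0 intro!: sum.cong)
  ultimately have "halves_diff h x 0 = sum_list (take h X) - sum_list (drop h X)"
    by (simp add: halves_diff_def)
  moreover have "set (take h X) \<subseteq> {1, -1}" "set (drop h X) \<subseteq> {1, -1}"
    using signs set_take_subset[of h X] set_drop_subset[of h X] by auto
  ultimately have "halves_diff h x 0
      = 2 * (int (hamming_weight (take h X)) - int (hamming_weight (drop h X)))"
    using len by (simp add: sum_list_eq_count_one hamming_weight_def)
  then show ?thesis using bound by linarith
qed

theorem theorem6:
  fixes m :: nat and X :: "int list"
  assumes "m \<ge> 1" and "odd m"
    and "X \<in> weight_class (4 * m^2) (int (2 * m^2 + m))"
    and "hadamard_mat (4 * m^2) (circulant_mat X)"
  shows "\<exists>a b :: int.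
    X \<in> concat_product (weight_class (2 * m^2) (2 * int m ^ 2 - a)) (weight_class (2 * m^2) b) \<and>
    (real m ^ 2 + real m) / 2 \<le> real_of_int (2 * int m ^ 2 - a) \<and>
    real_of_int (2 * int m ^ 2 - a) \<le> (3 * real m ^ 2 + real m) / 2 \<and>
    b = int m + a"
proof -
  define h where "h = 2 * m^2"
  define p where "p = hamming_weight (take h X)"
  define q where "q = hamming_weight (drop h X)"
  have X: "X \<in> Z2_seqs (2 * h)" and weight: "hamming_weight X = h + m"
    using assms(3) by (simp_all only: weight_class_def h_def mem_Collect_eq of_nat_eq_iff) simp
  have len: "length X = 2 * h" and signs: "set X \<subseteq> {1, -1}"
    using X by (auto simp: Z2_seqs_def)
  have "p + q = h + m"
    using weight count_list_append[of "take h X" "drop h X" 1]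
    by (simp add: p_def q_def hamming_weight_def)
  have diff: "\<bar>int p - int q\<bar> \<le> int (m^2)"
  proof (cases "m = 1")
    case True
    have "p \<le> h" "q \<le> h"
      using count_le_length[of "take h X" 1] count_le_length[of "drop h X" 1] len
      by (auto simp: p_def q_def hamming_weight_def)
    then show ?thesis using \<open>p + q = h + m\<close> True by (auto simp: h_def)
  next
    case False
    then have "3 \<le> m" using \<open>odd m\<close> \<open>m \<ge> 1\<close> by (cases "m = 2") auto
    then have "18 \<le> h" using power_mono[of 3 m 2] by (simp add: h_def)
    then have "2 * \<bar>int p - int q\<bar> < int h"
      using circulant_hadamard_half_weights[of h X] X assms(4) by (simp add: p_def q_def h_def)
    then show ?thesis by (simp add: h_def)
  qed
  have sums: "int p + int q = 2 * int (m^2) + int m"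
    using arg_cong[OF \<open>p + q = h + m\<close>, of int] by (simp add: h_def)
  have "int (m^2) + int m \<le> 2 * int p" "2 * int p \<le> 3 * int (m^2) + int m"
    using diff sums by linarith+
  then have bounds: "real m ^ 2 + real m \<le> 2 * real p" "2 * real p \<le> 3 * real m ^ 2 + real m"
    by (simp_all flip: of_nat_power)
  define a where "a = 2 * int m ^ 2 - int p"
  have "take h X \<in> weight_class (2 * m^2) (2 * int m ^ 2 - a)"
    using len signs set_take_subset[of h X]
    by (auto simp: weight_class_def Z2_seqs_def a_def p_def h_def)
  moreover have "drop h X \<in> weight_class (2 * m^2) (int q)"
    using len signs set_drop_subset[of h X]
    by (auto simp: weight_class_def Z2_seqs_def q_def h_def)
  ultimately have
    "X \<in> concat_product (weight_class (2 * m^2) (2 * int m ^ 2 - a)) (weight_class (2 * m^2) (int q))"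
    unfolding concat_product_def by (metis (mono_tags, lifting) append_take_drop_id mem_Collect_eq)
  moreover have "int q = int m + a"
    using sums by (simp add: a_def)
  ultimately show ?thesis using bounds
    by (intro exI[of _ a] exI[of _ "int q"]) (simp add: a_def)
qed

end
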